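(* Consider the sub-Riemannian problem on $\mathrm{SE}(3)$ (with $\xi=1$) described in the context, and let $u=(u_1,\dots,u_6):[0,t_1]\to\mathbb{R}^6$ be a solution of the vertical part $$\dot u_1=-u_3u_5,\quad \dot u_2=u_3u_4,\quad \dot u_3=u_1u_5-u_2u_4,\quad \dot u_4=u_2u_3-u_5u_6,\quad \dot u_5=u_4u_6-u_1u_3,\quad \dot u_6=0$$ of the Hamiltonian system of the Pontryagin maximum principle. Suppose $u_6(0)=0$. Then: (1) The vertical part (on extremal controls) takes the form $$\dot u_1=-u_3u_5,\quad \dot u_2=u_3u_4,\quad \dot u_3=u_1u_5-u_2u_4,\quad \dot u_4=u_2u_3,\quad \dot u_5=-u_1u_3 .$$ (2) The extremal controls $u_4,u_5$ are expressed via $U(t)=\int_0^t u_3(\tau)\,d\tau$ and the initial values by $$u_4(t)=\frac{u_2(0)+u_4(0)}{2}e^{U(t)}-\frac{u_2(0)-u_4(0)}{2}e^{-U(t)},$$ $$u_5(t)=\frac{u_1(0)+u_5(0)}{2}e^{-U(t)}-\frac{u_1(0)-u_5(0)}{2}e^{U(t)}.$$ (3) The extremal control $u_3$ is given in terms of the initial values as follows. Put $$A=(u_1(0)+u_5(0))^2+(u_2(0)-u_4(0))^2,\quad B=(u_1(0)-u_5(0))^2+(u_2(0)+u_4(0))^2,\quad b=\sqrt{u_3(0)^2+u_4(0)^2+u_5(0)^2}.$$ (I) If $u_1(0)=-u_5(0)$ and $u_2(0)=u_4(0)$ (equivalently $A=0$), then $$u_3(t)=\frac{(b+u_3(0))e^{-bt}-(b-u_3(0))e^{bt}}{\left(1+\frac{u_3(0)}{b}\right)e^{-bt}+\left(1-\frac{u_3(0)}{b}\right)e^{bt}}.$$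 (II) If $u_1(0)=u_5(0)$ and $u_2(0)=-u_4(0)$ (equivalently $B=0$), then $$u_3(t)=\frac{(b+u_3(0))e^{bt}-(b-u_3(0))e^{-bt}}{\left(1+\frac{u_3(0)}{b}\right)e^{bt}+\left(1-\frac{u_3(0)}{b}\right)e^{-bt}}.$$ (III) Otherwise (i.e. $AB\neq 0$, so $A>0$ and $B>0$), $$U(t)=\frac{y(t)}2-\frac14\ln\left(\frac BA\right),\qquad u_3(t)=\frac{\dot y(t)}2,$$ where $$y(t)=\ln\left(1+\frac{P^2}{2\sqrt{AB}}\left(\operatorname{cn}^2(\psi_t,k)+\frac1k\operatorname{cn}(\psi_t,k)\operatorname{dn}(\psi_t,k)\right)\right),\qquad \dot y(t)=-P\,\operatorname{sn}(\psi_t,k),$$ with $$P=\sqrt{4u_3(0)^2+(\sqrt A-\sqrt B)^2},\qquad Q=\sqrt{4u_3(0)^2+(\sqrt A+\sqrt B)^2},\qquad k=\frac PQ,$$ $$\psi_t=F(p_0,k)+\frac Q2\,t,\qquad p_0=\begin{cases}-\arcsin\left(\frac{2u_3(0)}{P}\right), & \text{if } B\ge A,\\[2pt] \pi+\arcsin\left(\frac{2u_3(0)}{P}\right), & \text{if } B<A.\end{cases}$$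
   Context: The sub-Riemannian problem on $\mathrm{SE}(3)$, the Lie group of Euclidean motions of $\mathbb{R}^3$: the group is parameterized by $(x,y,z)\in\mathbb{R}^3$ (translation) and angles $(\theta,\beta,\alpha)$ of rotation about the axes $OX,OY,OZ$ (the rotation part is the product $R_x(\theta)R_y(\beta)R_z(\alpha)$). Consider the left-invariant vector fields $\mathcal A_3=\sin\beta\,\partial_x-\cos\beta\sin\theta\,\partial_y+\cos\beta\cos\theta\,\partial_z$, $\mathcal A_4=-\cos\alpha\tan\beta\,\partial_\alpha+\sin\alpha\,\partial_\beta+\cos\alpha\sec\beta\,\partial_\theta$, $\mathcal A_5=\sin\alpha\tan\beta\,\partial_\alpha+\cos\alpha\,\partial_\beta-\sin\alpha\sec\beta\,\partial_\theta$. Given $q\in \mathrm{SE}(3)$ and fixed $t_1>0$, the problem is $$\dot\gamma=u_3\mathcal A_3+u_4\mathcal A_4+u_5\mathcal A_5,\quad \gamma(0)=e,\quad \gamma(t_1)=q,\quad \frac12\int_0^{t_1}(\xi^2u_3^2+u_4^2+u_5^2)\,dt\to\min,$$ with controls $u_3,u_4,u_5\in L_\infty(0,t_1)$, $e$ the identity, and $\xi>0$ a constant; it can be reduced to the case $\xi=1$, which is the case considered. Applying the Pontryagin maximum principle (PMP) yields a Hamiltonian system whose vertical part is the system of six ODEs for $u_1,\dots,u_6$ displayed at the start of the claim; it describes the dynamics of the extremal controls $u_3,u_4,u_5$ together with the remaining momentum components $u_1,u_2,u_6$. Notation: a dot denotes $d/dt$. $F(\varphi,k)=\int_0^\varphi\frac{ds}{\sqrt{1-k^2\sin^2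 s}}$ is the incomplete elliptic integral of the first kind with modulus $k$, and $\operatorname{sn}(\cdot,k),\operatorname{cn}(\cdot,k),\operatorname{dn}(\cdot,k)$ are the Jacobi elliptic functions of modulus $k$: if $\psi=F(\varphi,k)$, then $\operatorname{sn}(\psi,k)=\sin\varphi$, $\operatorname{cn}(\psi,k)=\cos\varphi$, $\operatorname{dn}(\psi,k)=\sqrt{1-k^2\sin^2\varphi}$. *)

theory Defs
  imports "HOL-Analysis.Analysis"
begin

definition vertical_part ::
  "real \<Rightarrow> (real \<Rightarrow> real) \<Rightarrow> (real \<Rightarrow> real) \<Rightarrow> (real \<Rightarrow> real) \<Rightarrow>
   (real \<Rightarrow> real) \<Rightarrow> (real \<Rightarrow> real) \<Rightarrow> (real \<Rightarrow> real) \<Rightarrow> bool" where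
  "vertical_part t1 u1 u2 u3 u4 u5 u6 \<longleftrightarrow>
     (\<forall>t\<in>{0..t1}.
        (u1 has_real_derivative - (u3 t * u5 t)) (at t within {0..t1}) \<and>
        (u2 has_real_derivative u3 t * u4 t) (at t within {0..t1}) \<and>
        (u3 has_real_derivative u1 t * u5 t - u2 t * u4 t) (at t within {0..t1}) \<and>
        (u4 has_real_derivative u2 t * u3 t - u5 t * u6 t) (at t within {0..t1}) \<and>
        (u5 has_real_derivative u4 t * u6 t - u1 t * u3 t) (at t within {0..t1}) \<and>
        (u6 has_real_derivative 0) (at t within {0..t1}))"

text \<open>
  The second argument of the elliptic functions is the modulus \<open>k\<close>, not the parameter \<open>m = k\<^sup>2\<close>.
  The integral is oriented, so \<open>ellF (- \<phi>) k = - ellF \<phi> k\<close>.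
\<close>

definition ellF :: "real \<Rightarrow> real \<Rightarrow> real" where
  "ellF \<phi> k = (LBINT s=0..\<phi>. 1 / sqrt (1 - k\<^sup>2 * (sin s)\<^sup>2))"

text \<open>
  For \<open>\<bar>k\<bar> < 1\<close> the map \<open>\<lambda>\<phi>. ellF \<phi> k\<close> is an increasing bijection of the real line, so the
  amplitude is well-defined there; nothing is intended for other values of \<open>k\<close>.
\<close>

definition jacobi_am :: "real \<Rightarrow> real \<Rightarrow> real" where
  "jacobi_am \<psi> k = (THE \<phi>. ellF \<phi> k = \<psi>)"

definition jacobi_sn :: "real \<Rightarrow> real \<Rightarrow> real" where
  "jacobi_sn \<psi> k = sin (jacobi_am \<psi> k)"

definition jacobi_cn :: "real \<Rightarrow> real \<Rightarrow> real" where
  "jacobi_cn \<psi> k = cos (jacobi_am \<psi> k)"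

definition jacobi_dn :: "real \<Rightarrow> real \<Rightarrow> real" where
  "jacobi_dn \<psi> k = sqrt (1 - k\<^sup>2 * (sin (jacobi_am \<psi> k))\<^sup>2)"

end

theory Submission
  imports Defs
begin

text \<open>
  Once \<open>u\<^sub>6 = 0\<close>, the four functions \<open>u\<^sub>1 \<plusminus> u\<^sub>5\<close> and \<open>u\<^sub>2 \<plusminus> u\<^sub>4\<close> satisfy scalar linear equations
  \<open>f' = \<plusminus> u\<^sub>3 f\<close>, so they are their initial values times \<open>exp (\<plusminus> U)\<close> with \<open>U' = u\<^sub>3\<close>
  (\<open>linear_ode_exp\<close>).  Half-differences of them are \<open>u\<^sub>4\<close> and \<open>u\<^sub>5\<close>.  Substitution into the
  equation for \<open>u\<^sub>3\<close> leaves the autonomous equation \<open>U'' = (A exp (- 2 U) - B exp (2 U)) / 4\<close>, whose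
  energy \<open>U'\<^sup>2 + (A exp (-2 U) + B exp (2 U)) / 4\<close> is conserved (\<open>energy_conservation\<close>).

  If \<open>A = 0\<close> or \<open>B = 0\<close>, conservation of energy eliminates the remaining exponential and turns the
  equation into \<open>u\<^sub>3' = \<plusminus> (u\<^sub>3\<^sup>2 - b\<^sup>2)\<close>, which \<open>riccati_solution\<close> solves.

  If \<open>A\<close> and \<open>B\<close> are positive, put \<open>p = \<surd>A exp (- U)\<close> and \<open>q = \<surd>B exp U\<close>.  Then \<open>p q = \<surd>(A B)\<close> is
  constant and \<open>u\<^sub>3' = (p\<^sup>2 - q\<^sup>2) / 4\<close>, so the plane vector \<open>(q - p, - 2 u\<^sub>3)\<close> rotates with
  angular velocity \<open>(p + q) / 2\<close> (\<open>rotating_vector\<close>).  Its constant length is \<open>P\<close> and its initial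
  angle is \<open>p\<^sub>0\<close> (\<open>initial_angle\<close>).  Writing \<open>\<phi>\<close> for the angle at time \<open>t\<close>, one has
  \<open>(p + q)\<^sup>2 = (q - p)\<^sup>2 + 4 p q = P\<^sup>2 cos\<^sup>2 \<phi> + 4 \<surd>(A B) = Q\<^sup>2 (1 - k\<^sup>2 sin\<^sup>2 \<phi>)\<close>, so
  \<open>\<phi>' = Q/2 \<surd>(1 - k\<^sup>2 sin\<^sup>2 \<phi>)\<close>; that is, \<open>F(\<phi>, k)\<close> grows at the constant rate \<open>Q/2\<close> and \<open>\<phi>\<close> is the
  Jacobi amplitude of \<open>\<psi>\<^sub>t\<close>.  The formula for \<open>u\<^sub>3\<close> is then the second component of the rotating
  vector, and the formula for \<open>exp y\<close> is \<open>q / p\<close> written in terms of \<open>\<phi>\<close>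
  (\<open>elliptic_solution\<close>).  Constructing the angle from the solution, rather than a solution from the
  elliptic functions, has the advantage that only the injectivity of \<open>F(\<cdot>, k)\<close> is needed to
  identify \<open>\<phi>\<close> as the amplitude.
\<close>

section \<open>Scalar and planar differential equations\<close>

lemma constant_if_derivative_zero:
  fixes f :: "real \<Rightarrow> real"
  assumes "\<And>t. t \<in> {0..T} \<Longrightarrow> (f has_real_derivative 0) (at t within {0..T})"
    and "t \<in> {0..T}"
  shows "f t = f 0"
proof -
  obtain c where "\<forall>x\<in>{0..T}. f x = c"
    using has_field_derivative_zero_constant[of "{0..T}" f] assms(1) by (metis convex_real_interval(5))
  with assms(2) show ?thesis by auto
qed

lemma linear_ode_exp:
  fixes f g U :: "real \<Rightarrow> real"
  assumes f: "\<And>t. t \<in> {0..T} \<Longrightarrow> (f has_real_derivative g t * f t) (at t within {0..T})"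
    and U: "\<And>t. t \<in> {0..T} \<Longrightarrow> (U has_real_derivative g t) (at t within {0..T})"
    and "U 0 = 0" "t \<in> {0..T}"
  shows "f t = f 0 * exp (U t)"
proof -
  have "((\<lambda>t. f t * exp (- U t)) has_real_derivative 0) (at s within {0..T})"
    if "s \<in> {0..T}" for s
    by (rule derivative_eq_intros f[OF that] U[OF that] refl)+ (simp add: algebra_simps)
  from constant_if_derivative_zero[OF this \<open>t \<in> {0..T}\<close>]
  have "f t * exp (- U t) = f 0" using \<open>U 0 = 0\<close> by simp
  then show ?thesis by (simp add: exp_minus field_simps)
qed

text \<open>
  The squared distance to the explicitly rotated vector is constant, because both vectors solve
  the same linear system with an antisymmetric matrix; it vanishes at time 0.
\<close>

lemma rotating_vector:
  fixes X V \<phi> \<omega> :: "real \<Rightarrow> real"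
  assumes X: "\<And>t. t \<in> {0..T} \<Longrightarrow> (X has_real_derivative - (\<omega> t * V t)) (at t within {0..T})"
    and V: "\<And>t. t \<in> {0..T} \<Longrightarrow> (V has_real_derivative \<omega> t * X t) (at t within {0..T})"
    and \<phi>: "\<And>t. t \<in> {0..T} \<Longrightarrow> (\<phi> has_real_derivative \<omega> t) (at t within {0..T})"
    and "X 0 = P * cos (\<phi> 0)" "V 0 = P * sin (\<phi> 0)" "t \<in> {0..T}"
  shows "X t = P * cos (\<phi> t)" "V t = P * sin (\<phi> t)"
proof -
  define D where "D t = (X t - P * cos (\<phi> t))\<^sup>2 + (V t - P * sin (\<phi> t))\<^sup>2" for t
  have "(D has_real_derivative 0) (at s within {0..T})" if "s \<in> {0..T}" for s
    unfolding D_def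
    by (rule derivative_eq_intros X[OF that] V[OF that] \<phi>[OF that] refl)+ (simp add: algebra_simps)
  from constant_if_derivative_zero[OF this \<open>t \<in> {0..T}\<close>]
  have "D t = 0" using assms(4,5) by (simp add: D_def)
  then show "X t = P * cos (\<phi> t)" "V t = P * sin (\<phi> t)"
    by (simp_all add: D_def sum_power2_eq_zero_iff)
qed

text \<open>
  With \<open>N\<close> and \<open>D\<close> for the numerator and the denominator of the right-hand side, both multiplied by \<open>b\<close>,
  one has \<open>D' = - N\<close> and \<open>N' = - b\<^sup>2 D\<close>, so the defect \<open>v D - N\<close> satisfies \<open>w' = v w\<close> and
  vanishes with its initial value.  The bound on \<open>v 0\<close> keeps the denominator positive; for
  \<open>b = 0\<close> it forces \<open>v 0 = 0\<close>, and both sides are zero.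
\<close>

lemma riccati_solution:
  fixes v W :: "real \<Rightarrow> real"
  assumes v: "\<And>t. t \<in> {0..T} \<Longrightarrow> (v has_real_derivative (v t)\<^sup>2 - b\<^sup>2) (at t within {0..T})"
    and W: "\<And>t. t \<in> {0..T} \<Longrightarrow> (W has_real_derivative v t) (at t within {0..T})"
    and "W 0 = 0" and bound: "\<bar>v 0\<bar> \<le> b" and "t \<in> {0..T}"
  shows "v t = ((b + v 0) * exp (- b * t) - (b - v 0) * exp (b * t)) /
               ((1 + v 0 / b) * exp (- b * t) + (1 - v 0 / b) * exp (b * t))"
proof (cases "b = 0")
  case True
  then have "v t = v 0 * exp (W t)"
    using v by (intro linear_ode_exp[OF _ W \<open>W 0 = 0\<close> \<open>t \<in> {0..T}\<close>])
      (auto simp: power2_eq_square)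
  with True bound show ?thesis by simp
next
  case False
  with bound have "b > 0" by linarith
  define D where "D t = (b + v 0) * exp (- b * t) + (b - v 0) * exp (b * t)" for t
  define N where "N t = b * ((b + v 0) * exp (- b * t) - (b - v 0) * exp (b * t))" for t
  have "((\<lambda>t. v t * D t - N t) has_real_derivative v s * (v s * D s - N s)) (at s within {0..T})"
    if "s \<in> {0..T}" for s
    unfolding D_def N_def
    by (rule derivative_eq_intros v[OF that] refl)+
      (simp add: algebra_simps power2_eq_square)
  from linear_ode_exp[OF this W \<open>W 0 = 0\<close> \<open>t \<in> {0..T}\<close>]
  have eq: "v t * D t = N t" by (simp add: D_def N_def algebra_simps)
  have "D t > 0"
  proof (cases "v 0 < b")
    case True
    then show ?thesis using bound unfolding D_def by (intro add_nonneg_pos) auto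
  next
    case False
    then have "v 0 = b" using bound by linarith
    then show ?thesis using \<open>b > 0\<close> by (simp add: D_def)
  qed
  with eq have "v t = (N t / b) / (D t / b)" using \<open>b > 0\<close> by (simp add: field_simps)
  also have "N t / b = (b + v 0) * exp (- b * t) - (b - v 0) * exp (b * t)"
    using \<open>b > 0\<close> by (simp add: N_def)
  also have "D t / b = (1 + v 0 / b) * exp (- b * t) + (1 - v 0 / b) * exp (b * t)"
    using \<open>b > 0\<close> by (simp add: D_def field_simps)
  finally show ?thesis .
qed

section \<open>The elliptic integral and the amplitude\<close>

lemma elliptic_radicand_pos:
  fixes k s :: real
  assumes "\<bar>k\<bar> < 1"
  shows "0 < 1 - k\<^sup>2 * (sin s)\<^sup>2"
proof -
  have "k\<^sup>2 * (sin s)\<^sup>2 \<le> k\<^sup>2 * 1"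
    by (intro mult_left_mono) (auto simp: abs_square_le_1)
  also have "\<dots> < 1" using assms by (simp add: abs_square_less_1)
  finally show ?thesis by simp
qed

lemma ellF_has_derivative:
  assumes "\<bar>k\<bar> < 1"
  shows "((\<lambda>x. ellF x k) has_real_derivative 1 / sqrt (1 - k\<^sup>2 * (sin \<phi>)\<^sup>2)) (at \<phi>)"
proof -
  let ?f = "\<lambda>s::real. 1 / sqrt (1 - k\<^sup>2 * (sin s)\<^sup>2)"
  let ?c = "\<bar>\<phi>\<bar> + 1"
  have "1 - k\<^sup>2 * (sin s)\<^sup>2 \<noteq> 0" for s
    using elliptic_radicand_pos[OF assms, of s] by linarith
  then have "continuous_on {- ?c..?c} ?f"
    by (intro continuous_intros) auto
  then have "((\<lambda>x. LBINT s=0..x. ?f s) has_vector_derivative ?f \<phi>) (at \<phi> within {- ?c..?c})"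
    using interval_integral_FTC2[of "- ?c" 0 ?c ?f \<phi>] by (auto simp: zero_ereal_def)
  moreover have "at \<phi> within {- ?c..?c} = at \<phi>"
    by (rule at_within_Icc_at) auto
  ultimately show ?thesis
    by (simp add: ellF_def has_real_derivative_iff_has_vector_derivative)
qed

lemma jacobi_am_ellF:
  assumes "\<bar>k\<bar> < 1"
  shows "jacobi_am (ellF \<phi> k) k = \<phi>"
proof -
  have "ellF x k < ellF x' k" if "x < x'" for x x'
  proof (rule DERIV_pos_imp_increasing[OF that])
    fix s
    show "\<exists>d. ((\<lambda>x. ellF x k) has_real_derivative d) (at s) \<and> d > 0"
      using ellF_has_derivative[OF assms, of s] elliptic_radicand_pos[OF assms, of s] by auto
  qed
  then have "inj (\<lambda>x. ellF x k)"
    by (intro injI) (metis less_irrefl linorder_neqE)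
  then show ?thesis
    unfolding jacobi_am_def by (auto intro: the_equality dest: injD)
qed

section \<open>The equation for the integral of the third control\<close>

lemma energy_conservation:
  fixes g U :: "real \<Rightarrow> real"
  assumes U: "\<And>t. t \<in> {0..T} \<Longrightarrow> (U has_real_derivative g t) (at t within {0..T})"
    and g: "\<And>t. t \<in> {0..T} \<Longrightarrow>
      (g has_real_derivative (A * exp (- 2 * U t) - B * exp (2 * U t)) / 4) (at t within {0..T})"
    and "U 0 = 0" "t \<in> {0..T}"
  shows "(g t)\<^sup>2 + (A * exp (- 2 * U t) + B * exp (2 * U t)) / 4 = (g 0)\<^sup>2 + (A + B) / 4"
proof -
  have "((\<lambda>t. (g t)\<^sup>2 + (A * exp (- 2 * U t) + B * exp (2 * U t)) / 4) has_real_derivative 0)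
      (at s within {0..T})" if "s \<in> {0..T}" for s
  proof -
    have "((\<lambda>t. A * exp (- 2 * U t) + B * exp (2 * U t)) has_real_derivative
        - 2 * g s * (A * exp (- 2 * U s) - B * exp (2 * U s))) (at s within {0..T})"
      by (rule derivative_eq_intros U[OF that] refl)+ (simp add: algebra_simps)
    from DERIV_add[OF DERIV_power[OF g[OF that], of 2] DERIV_cdivide[OF this, of 4]]
    show ?thesis by (rule DERIV_cong) (simp add: field_simps)
  qed
  from constant_if_derivative_zero[OF this \<open>t \<in> {0..T}\<close>] show ?thesis
    using \<open>U 0 = 0\<close> by simp
qed

text \<open>
  Here \<open>r = \<surd>A\<close> and \<open>s = \<surd>B\<close>; the two branches of \<open>p0\<close> choose the sign of the cosine.  For
  \<open>P = 0\<close> one has \<open>c = 0\<close> and \<open>r = s\<close>, and both sides are zero whatever value division by zero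
  gives to \<open>p0\<close>.
\<close>

lemma initial_angle:
  fixes r s c P p0 :: real
  assumes P: "P = sqrt (4 * c\<^sup>2 + (r - s)\<^sup>2)"
    and p0: "p0 = (if s \<ge> r then - arcsin (2 * c / P) else pi + arcsin (2 * c / P))"
  shows "P * cos p0 = s - r" "P * sin p0 = - 2 * c"
proof -
  have sq: "P\<^sup>2 = 4 * c\<^sup>2 + (r - s)\<^sup>2" and "P \<ge> 0" by (simp_all add: P)
  have "P * cos p0 = s - r \<and> P * sin p0 = - 2 * c"
  proof (cases "P = 0")
    case True
    then show ?thesis using sq by (simp add: sum_power2_eq_zero_iff add_nonneg_eq_0_iff)
  next
    case False
    with \<open>P \<ge> 0\<close> have "P > 0" by simp
    have "(2 * c)\<^sup>2 \<le> P\<^sup>2" using sq by (simp add: power_mult_distrib)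
    then have "\<bar>2 * c\<bar> \<le> P" using \<open>P > 0\<close> by (simp only: abs_le_square_iff[symmetric])
    then have range: "- 1 \<le> 2 * c / P" "2 * c / P \<le> 1" using \<open>P > 0\<close> by (auto simp: field_simps)
    have "P * sqrt (1 - (2 * c / P)\<^sup>2) = sqrt (P\<^sup>2 * (1 - (2 * c / P)\<^sup>2))"
      using \<open>P > 0\<close> by (simp add: real_sqrt_mult)
    also have "P\<^sup>2 * (1 - (2 * c / P)\<^sup>2) = P\<^sup>2 - 4 * c\<^sup>2"
      using \<open>P > 0\<close> by (simp add: right_diff_distrib power_mult_distrib power_divide)
    also have "\<dots> = (r - s)\<^sup>2" by (simp add: sq)
    finally have "P * cos (arcsin (2 * c / P)) = \<bar>r - s\<bar>"
      using range by (simp add: cos_arcsin)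
    then show ?thesis
      using range \<open>P > 0\<close> by (auto simp: p0 sin_add cos_add)
  qed
  then show "P * cos p0 = s - r" "P * sin p0 = - 2 * c" by auto
qed

text \<open>
  With \<open>p = \<surd>A exp (- U)\<close> and \<open>q = \<surd>B exp U\<close>, the vector \<open>(q - p, - 2 g)\<close> has length \<open>P\<close> and its
  angle is the Jacobi amplitude of \<open>\<psi>\<close>.  Hence \<open>- 2 g = P sn\<close>, and \<open>q / p = \<surd>(B / A) exp (2 U)\<close> is the
  argument of the logarithm, because \<open>P cn = q - p\<close> and \<open>Q dn = p + q\<close>.
\<close>

lemma elliptic_solution:
  fixes g U :: "real \<Rightarrow> real"
  assumes U: "\<And>t. t \<in> {0..T} \<Longrightarrow> (U has_real_derivative g t) (at t within {0..T})"
    and g: "\<And>t. t \<in> {0..T} \<Longrightarrow>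
      (g has_real_derivative (A * exp (- 2 * U t) - B * exp (2 * U t)) / 4) (at t within {0..T})"
    and U0: "U 0 = 0" and "A > 0" "B > 0"
    and P: "P = sqrt (4 * (g 0)\<^sup>2 + (sqrt A - sqrt B)\<^sup>2)"
    and Q: "Q = sqrt (4 * (g 0)\<^sup>2 + (sqrt A + sqrt B)\<^sup>2)"
    and k: "k = P / Q"
    and p0: "p0 = (if B \<ge> A then - arcsin (2 * g 0 / P) else pi + arcsin (2 * g 0 / P))"
    and \<psi>: "\<psi> = ellF p0 k + Q / 2 * t"
    and t: "t \<in> {0..T}"
  shows "g t = - P * jacobi_sn \<psi> k / 2"
    and "ln (1 + P\<^sup>2 / (2 * sqrt (A * B)) *
           ((jacobi_cn \<psi> k)\<^sup>2 + 1 / k * jacobi_cn \<psi> k * jacobi_dn \<psi> k))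
         = 2 * U t + ln (B / A) / 2"
proof -
  define p where "p t = sqrt A * exp (- U t)" for t
  define q where "q t = sqrt B * exp (U t)" for t
  define \<omega> where "\<omega> t = (p t + q t) / 2" for t
  \<comment> \<open>The angle of the vector \<open>(q - p, - 2 g)\<close>, obtained as the integral of its angular velocity.\<close>
  define \<phi> where "\<phi> t = p0 + integral {0..t} \<omega>" for t
  have pos: "p t > 0" "q t > 0" for t
    using \<open>A > 0\<close> \<open>B > 0\<close> by (auto simp: p_def q_def)
  have pq: "p t * q t = sqrt (A * B)" for t
    by (simp add: p_def q_def real_sqrt_mult exp_minus)
  have squares: "(p t)\<^sup>2 = A * exp (- 2 * U t)" "(q t)\<^sup>2 = B * exp (2 * U t)" for t
    using \<open>A > 0\<close> \<open>B > 0\<close> by (simp_all add: p_def q_def power_mult_distrib flip: exp_double)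
  have p: "(p has_real_derivative - g t * p t) (at t within {0..T})"
    and q: "(q has_real_derivative g t * q t) (at t within {0..T})" if "t \<in> {0..T}" for t
    unfolding p_def q_def by (rule derivative_eq_intros U[OF that] refl | simp)+
  have "continuous_on {0..T} p" "continuous_on {0..T} q"
    by (rule DERIV_continuous_on, erule p) (rule DERIV_continuous_on, erule q)
  then have "continuous_on {0..T} \<omega>"
    unfolding \<omega>_def by (intro continuous_intros) auto
  then have \<phi>: "(\<phi> has_real_derivative \<omega> t) (at t within {0..T})" if "t \<in> {0..T}" for t
    unfolding \<phi>_def using that
    by (auto intro!: derivative_eq_intros integral_has_real_derivative)
  have X: "((\<lambda>t. q t - p t) has_real_derivative - (\<omega> t * (- 2 * g t))) (at t within {0..T})"
    if "t \<in> {0..T}" for t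
    by (rule derivative_eq_intros p[OF that] q[OF that] refl)+ (simp add: \<omega>_def field_simps)
  have V: "((\<lambda>t. - 2 * g t) has_real_derivative \<omega> t * (q t - p t)) (at t within {0..T})"
    if "t \<in> {0..T}" for t
    by (rule derivative_eq_intros g[OF that] refl)+
      (simp only: \<omega>_def squares[symmetric], simp add: power2_eq_square field_simps)
  have "\<phi> 0 = p0" by (simp add: \<phi>_def)
  moreover have "sqrt B \<ge> sqrt A \<longleftrightarrow> B \<ge> A" by simp
  ultimately have start: "q 0 - p 0 = P * cos (\<phi> 0)" "- 2 * g 0 = P * sin (\<phi> 0)"
    using initial_angle[OF P, of p0] p0 U0 by (simp_all add: p_def q_def)
  have cos: "q t - p t = P * cos (\<phi> t)" and sin: "- 2 * g t = P * sin (\<phi> t)"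
    if "t \<in> {0..T}" for t
    using rotating_vector[OF X V \<phi> start that] by auto

  have AB: "sqrt A * sqrt B > 0" using \<open>A > 0\<close> \<open>B > 0\<close> by simp
  have P2: "P\<^sup>2 = 4 * (g 0)\<^sup>2 + (sqrt A - sqrt B)\<^sup>2" and "P \<ge> 0" by (simp_all add: P)
  have "Q\<^sup>2 = 4 * (g 0)\<^sup>2 + (sqrt A + sqrt B)\<^sup>2" and "Q \<ge> 0" by (simp_all add: Q)
  then have Q2: "Q\<^sup>2 = P\<^sup>2 + 4 * sqrt (A * B)"
    by (simp add: P2 power2_sum power2_diff real_sqrt_mult)
  then have "P\<^sup>2 < Q\<^sup>2" using AB by (simp add: real_sqrt_mult)
  then have "P < Q" using \<open>Q \<ge> 0\<close> by (rule power_less_imp_less_base)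
  then have "Q > 0" "\<bar>k\<bar> < 1" using \<open>P \<ge> 0\<close> by (auto simp: k)
  have dn: "Q * sqrt (1 - k\<^sup>2 * (sin (\<phi> t))\<^sup>2) = p t + q t" if "t \<in> {0..T}" for t
  proof -
    have "Q * sqrt (1 - k\<^sup>2 * (sin (\<phi> t))\<^sup>2) = sqrt (Q\<^sup>2 * (1 - k\<^sup>2 * (sin (\<phi> t))\<^sup>2))"
      using \<open>Q > 0\<close> by (simp add: real_sqrt_mult)
    also have "Q\<^sup>2 * (1 - k\<^sup>2 * (sin (\<phi> t))\<^sup>2) = Q\<^sup>2 - P\<^sup>2 * (sin (\<phi> t))\<^sup>2"
      using \<open>Q > 0\<close> by (simp add: k power_divide field_simps)
    also have "\<dots> = (P * cos (\<phi> t))\<^sup>2 + 4 * sqrt (A * B)"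
      by (simp add: Q2 power_mult_distrib cos_squared_eq algebra_simps)
    also have "\<dots> = (p t + q t)\<^sup>2"
      unfolding cos[OF that, symmetric] pq[of t, symmetric]
      by (simp add: power2_eq_square algebra_simps)
    finally show ?thesis using pos[of t] by simp
  qed
  have "((\<lambda>t. ellF (\<phi> t) k - Q / 2 * t) has_real_derivative 0) (at s within {0..T})"
    if "s \<in> {0..T}" for s
  proof -
    let ?d = "sqrt (1 - k\<^sup>2 * (sin (\<phi> s))\<^sup>2)"
    have "((\<lambda>t. ellF (\<phi> t) k) has_real_derivative 1 / ?d * \<omega> s) (at s within {0..T})"
      by (rule DERIV_chain2[OF ellF_has_derivative[OF \<open>\<bar>k\<bar> < 1\<close>] \<phi>[OF that]])
    moreover have "1 / ?d * \<omega> s = Q / 2"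
      using dn[OF that] elliptic_radicand_pos[OF \<open>\<bar>k\<bar> < 1\<close>, of "\<phi> s"]
      by (simp add: \<omega>_def field_simps)
    ultimately show ?thesis by (auto intro!: derivative_eq_intros)
  qed
  from constant_if_derivative_zero[OF this t]
  have "\<psi> = ellF (\<phi> t) k" using \<open>\<phi> 0 = p0\<close> by (simp add: \<psi>)
  then have am: "jacobi_am \<psi> k = \<phi> t" using jacobi_am_ellF[OF \<open>\<bar>k\<bar> < 1\<close>] by simp
  show "g t = - P * jacobi_sn \<psi> k / 2"
    using sin[OF t] by (simp add: jacobi_sn_def am)

  have cn: "P * jacobi_cn \<psi> k = q t - p t" and dn': "Q * jacobi_dn \<psi> k = p t + q t"
    using cos[OF t] dn[OF t] by (simp_all add: jacobi_cn_def jacobi_dn_def am)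
  \<comment> \<open>\<open>P\<^sup>2 / k = P Q\<close> also holds for \<open>P = 0\<close>, where both sides are zero.\<close>
  have "P\<^sup>2 * ((jacobi_cn \<psi> k)\<^sup>2 + 1 / k * jacobi_cn \<psi> k * jacobi_dn \<psi> k)
      = (P * jacobi_cn \<psi> k)\<^sup>2 + (P * jacobi_cn \<psi> k) * (Q * jacobi_dn \<psi> k)"
    using \<open>Q > 0\<close> by (cases "P = 0") (simp_all add: k field_simps power2_eq_square)
  also have "\<dots> = 2 * q t * (q t - p t)"
    unfolding cn dn' by (simp add: power2_eq_square algebra_simps)
  finally have "1 + P\<^sup>2 / (2 * sqrt (A * B)) *
      ((jacobi_cn \<psi> k)\<^sup>2 + 1 / k * jacobi_cn \<psi> k * jacobi_dn \<psi> k)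
      = 1 + 2 * q t * (q t - p t) / (2 * (p t * q t))"
    by (simp add: pq)
  also have "\<dots> = q t / p t"
    using pos[of t] by (simp add: field_simps)
  also have "ln \<dots> = ln (sqrt B) - ln (sqrt A) + 2 * U t"
    using pos[of t] \<open>A > 0\<close> \<open>B > 0\<close> by (simp add: p_def q_def ln_div ln_mult)
  also have "\<dots> = 2 * U t + ln (B / A) / 2"
    using \<open>A > 0\<close> \<open>B > 0\<close> by (simp add: ln_sqrt ln_div)
  finally show "ln (1 + P\<^sup>2 / (2 * sqrt (A * B)) *
      ((jacobi_cn \<psi> k)\<^sup>2 + 1 / k * jacobi_cn \<psi> k * jacobi_dn \<psi> k)) = 2 * U t + ln (B / A) / 2" .
qed

section \<open>The extremal controls\<close>

theorem theorem1:
  fixes u1 u2 u3 u4 u5 u6 :: "real \<Rightarrow> real"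
    and t1 A B b P Q k p0 :: real
    and U \<psi> y :: "real \<Rightarrow> real"
  assumes t1: "t1 > 0"
    and sol: "vertical_part t1 u1 u2 u3 u4 u5 u6"
    and u6_0: "u6 0 = 0"
    and U: "\<And>t. U t = integral {0..t} u3"
    and A: "A = (u1 0 + u5 0)\<^sup>2 + (u2 0 - u4 0)\<^sup>2"
    and B: "B = (u1 0 - u5 0)\<^sup>2 + (u2 0 + u4 0)\<^sup>2"
    and b: "b = sqrt ((u3 0)\<^sup>2 + (u4 0)\<^sup>2 + (u5 0)\<^sup>2)"
    and P: "P = sqrt (4 * (u3 0)\<^sup>2 + (sqrt A - sqrt B)\<^sup>2)"
    and Q: "Q = sqrt (4 * (u3 0)\<^sup>2 + (sqrt A + sqrt B)\<^sup>2)"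
    and k: "k = P / Q"
    and p0: "p0 = (if B \<ge> A then - arcsin (2 * u3 0 / P) else pi + arcsin (2 * u3 0 / P))"
    and \<psi>: "\<And>t. \<psi> t = ellF p0 k + Q / 2 * t"
    and y: "\<And>t. y t = ln (1 + P\<^sup>2 / (2 * sqrt (A * B)) *
                ((jacobi_cn (\<psi> t) k)\<^sup>2 + 1 / k * jacobi_cn (\<psi> t) k * jacobi_dn (\<psi> t) k))"
  shows
    "(\<forall>t\<in>{0..t1}.
        u6 t = 0 \<and>
        (u1 has_real_derivative - (u3 t * u5 t)) (at t within {0..t1}) \<and>
        (u2 has_real_derivative u3 t * u4 t) (at t within {0..t1}) \<and>
        (u3 has_real_derivative u1 t * u5 t - u2 t * u4 t) (at t within {0..t1}) \<and>
        (u4 has_real_derivative u2 t * u3 t) (at t within {0..t1}) \<and>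
        (u5 has_real_derivative - (u1 t * u3 t)) (at t within {0..t1})) \<and>
     (\<forall>t\<in>{0..t1}.
        u4 t = (u2 0 + u4 0) / 2 * exp (U t) - (u2 0 - u4 0) / 2 * exp (- U t) \<and>
        u5 t = (u1 0 + u5 0) / 2 * exp (- U t) - (u1 0 - u5 0) / 2 * exp (U t)) \<and>
     (u1 0 = - u5 0 \<and> u2 0 = u4 0 \<longleftrightarrow> A = 0) \<and>
     (u1 0 = u5 0 \<and> u2 0 = - u4 0 \<longleftrightarrow> B = 0) \<and>
     (u1 0 = - u5 0 \<and> u2 0 = u4 0 \<longrightarrow>
        (\<forall>t\<in>{0..t1}.
           u3 t = ((b + u3 0) * exp (- b * t) - (b - u3 0) * exp (b * t)) /
                  ((1 + u3 0 / b) * exp (- b * t) + (1 - u3 0 / b) * exp (b * t)))) \<and>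
     (u1 0 = u5 0 \<and> u2 0 = - u4 0 \<longrightarrow>
        (\<forall>t\<in>{0..t1}.
           u3 t = ((b + u3 0) * exp (b * t) - (b - u3 0) * exp (- b * t)) /
                  ((1 + u3 0 / b) * exp (b * t) + (1 - u3 0 / b) * exp (- b * t)))) \<and>
     (\<not> (u1 0 = - u5 0 \<and> u2 0 = u4 0) \<and> \<not> (u1 0 = u5 0 \<and> u2 0 = - u4 0) \<longrightarrow>
        A > 0 \<and> B > 0 \<and>
        (\<forall>t\<in>{0..t1}.
           U t = y t / 2 - 1 / 4 * ln (B / A) \<and>
           (y has_real_derivative - P * jacobi_sn (\<psi> t) k) (at t within {0..t1}) \<and>
           u3 t = (- P * jacobi_sn (\<psi> t) k) / 2))"
proof -
  have u6: "u6 t = 0" if "t \<in> {0..t1}" for t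
    using constant_if_derivative_zero[of t1 u6 t] sol that u6_0 by (auto simp: vertical_part_def)
  have d1: "(u1 has_real_derivative - (u3 t * u5 t)) (at t within {0..t1})"
    and d2: "(u2 has_real_derivative u3 t * u4 t) (at t within {0..t1})"
    and d3: "(u3 has_real_derivative u1 t * u5 t - u2 t * u4 t) (at t within {0..t1})"
    and d4: "(u4 has_real_derivative u2 t * u3 t) (at t within {0..t1})"
    and d5: "(u5 has_real_derivative - (u1 t * u3 t)) (at t within {0..t1})"
    if "t \<in> {0..t1}" for t
    using sol u6[OF that] that by (force simp: vertical_part_def)+

  have "continuous_on {0..t1} u3" by (rule DERIV_continuous_on[OF d3])
  then have dU: "(U has_real_derivative u3 t) (at t within {0..t1})" if "t \<in> {0..t1}" for t
    using integral_has_real_derivative[of 0 t1 u3 t] that by (simp add: U[abs_def])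
  then have dmU: "((\<lambda>t. - U t) has_real_derivative - u3 t) (at t within {0..t1})"
    if "t \<in> {0..t1}" for t using that by (auto intro: DERIV_minus)
  have U0: "U 0 = 0" by (simp add: U)

  have s15: "u1 t + u5 t = (u1 0 + u5 0) * exp (- U t)" if "t \<in> {0..t1}" for t
    by (rule linear_ode_exp[of t1 "\<lambda>t. u1 t + u5 t", OF _ dmU _ that])
      (auto intro!: derivative_eq_intros d1 d5 simp: U0 algebra_simps)
  have m15: "u1 t - u5 t = (u1 0 - u5 0) * exp (U t)" if "t \<in> {0..t1}" for t
    by (rule linear_ode_exp[of t1 "\<lambda>t. u1 t - u5 t", OF _ dU U0 that])
      (auto intro!: derivative_eq_intros d1 d5 simp: algebra_simps)
  have s24: "u2 t + u4 t = (u2 0 + u4 0) * exp (U t)" if "t \<in> {0..t1}" for t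
    by (rule linear_ode_exp[of t1 "\<lambda>t. u2 t + u4 t", OF _ dU U0 that])
      (auto intro!: derivative_eq_intros d2 d4 simp: algebra_simps)
  have m24: "u2 t - u4 t = (u2 0 - u4 0) * exp (- U t)" if "t \<in> {0..t1}" for t
    by (rule linear_ode_exp[of t1 "\<lambda>t. u2 t - u4 t", OF _ dmU _ that])
      (auto intro!: derivative_eq_intros d2 d4 simp: U0 algebra_simps)
  have u45: "u4 t = (u2 0 + u4 0) / 2 * exp (U t) - (u2 0 - u4 0) / 2 * exp (- U t) \<and>
      u5 t = (u1 0 + u5 0) / 2 * exp (- U t) - (u1 0 - u5 0) / 2 * exp (U t)"
    if "t \<in> {0..t1}" for t
    using s15[OF that] m15[OF that] s24[OF that] m24[OF that] by argo

  \<comment> \<open>\<open>4 (u\<^sub>1 u\<^sub>5 - u\<^sub>2 u\<^sub>4)\<close> is a combination of the squares of the four explicitly known functions.\<close>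
  have "u1 t * u5 t - u2 t * u4 t = (A * exp (- 2 * U t) - B * exp (2 * U t)) / 4"
    if "t \<in> {0..t1}" for t
  proof -
    have "u1 t * u5 t - u2 t * u4 t =
        ((u1 t + u5 t)\<^sup>2 + (u2 t - u4 t)\<^sup>2 - ((u1 t - u5 t)\<^sup>2 + (u2 t + u4 t)\<^sup>2)) / 4"
      by (simp add: power2_eq_square algebra_simps)
    also have "\<dots> = (A * (exp (- U t))\<^sup>2 - B * (exp (U t))\<^sup>2) / 4"
      unfolding s15[OF that] m15[OF that] s24[OF that] m24[OF that] A B
      by (simp only: power_mult_distrib) (simp only: distrib_right)
    finally show ?thesis by (simp flip: exp_double)
  qed
  with d3 have du3: "(u3 has_real_derivative (A * exp (- 2 * U t) - B * exp (2 * U t)) / 4)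
      (at t within {0..t1})" if "t \<in> {0..t1}" for t using that by simp
  have energy: "(u3 t)\<^sup>2 + (A * exp (- 2 * U t) + B * exp (2 * U t)) / 4 = (u3 0)\<^sup>2 + (A + B) / 4"
    if "t \<in> {0..t1}" for t
    by (rule energy_conservation[OF dU du3 U0 that])

  have A0: "u1 0 = - u5 0 \<and> u2 0 = u4 0 \<longleftrightarrow> A = 0"
    and B0: "u1 0 = u5 0 \<and> u2 0 = - u4 0 \<longleftrightarrow> B = 0"
    by (auto simp: A B sum_power2_eq_zero_iff)
  have b2: "b\<^sup>2 = (u3 0)\<^sup>2 + (u4 0)\<^sup>2 + (u5 0)\<^sup>2" by (simp add: b)
  have bound: "\<bar>u3 0\<bar> \<le> b" unfolding b by (rule real_le_rsqrt) simp

  have case_I: "u3 t = ((b + u3 0) * exp (- b * t) - (b - u3 0) * exp (b * t)) /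
      ((1 + u3 0 / b) * exp (- b * t) + (1 - u3 0 / b) * exp (b * t))"
    if init: "u1 0 = - u5 0 \<and> u2 0 = u4 0" and t: "t \<in> {0..t1}" for t
  proof (rule riccati_solution[OF _ dU U0 bound t])
    fix s assume s: "s \<in> {0..t1}"
    have "A = 0" using A0 init by simp
    have "b\<^sup>2 = (u3 0)\<^sup>2 + B / 4"
      unfolding b2 B using init by (simp add: power2_eq_square field_simps)
    then have "(A * exp (- 2 * U s) - B * exp (2 * U s)) / 4 = (u3 s)\<^sup>2 - b\<^sup>2"
      using energy[OF s] \<open>A = 0\<close> by simp
    then show "(u3 has_real_derivative (u3 s)\<^sup>2 - b\<^sup>2) (at s within {0..t1})"
      by (rule DERIV_cong[OF du3[OF s]])
  qed

  \<comment> \<open>Changing the sign of \<open>u\<^sub>3\<close> reduces this to the equation of the previous case.\<close>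
  have case_II: "u3 t = ((b + u3 0) * exp (b * t) - (b - u3 0) * exp (- b * t)) /
      ((1 + u3 0 / b) * exp (b * t) + (1 - u3 0 / b) * exp (- b * t))"
    if init: "u1 0 = u5 0 \<and> u2 0 = - u4 0" and t: "t \<in> {0..t1}" for t
  proof -
    have "- u3 t = ((b + - u3 0) * exp (- b * t) - (b - - u3 0) * exp (b * t)) /
        ((1 + - u3 0 / b) * exp (- b * t) + (1 - - u3 0 / b) * exp (b * t))"
    proof (rule riccati_solution[of t1 "\<lambda>t. - u3 t", OF _ dmU _ _ t])
      fix s assume s: "s \<in> {0..t1}"
      have "B = 0" using B0 init by simp
      have "b\<^sup>2 = (u3 0)\<^sup>2 + A / 4"
        unfolding b2 A using init by (simp add: power2_eq_square field_simps)
      then have "- ((A * exp (- 2 * U s) - B * exp (2 * U s)) / 4) = (- u3 s)\<^sup>2 - b\<^sup>2"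
        using energy[OF s] \<open>B = 0\<close> by simp
      then show "((\<lambda>t. - u3 t) has_real_derivative (- u3 s)\<^sup>2 - b\<^sup>2) (at s within {0..t1})"
        by (rule DERIV_cong[OF DERIV_minus[OF du3[OF s]]])
    qed (use U0 bound in auto)
    then have "u3 t = - (((b - u3 0) * exp (- b * t) - (b + u3 0) * exp (b * t)) /
        ((1 - u3 0 / b) * exp (- b * t) + (1 + u3 0 / b) * exp (b * t)))"
      by simp
    then show ?thesis
      by (simp only: minus_divide_left minus_diff_eq add.commute)
  qed

  have case_III: "A > 0 \<and> B > 0 \<and> (\<forall>t\<in>{0..t1}.
      U t = y t / 2 - 1 / 4 * ln (B / A) \<and>
      (y has_real_derivative - P * jacobi_sn (\<psi> t) k) (at t within {0..t1}) \<and>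
      u3 t = (- P * jacobi_sn (\<psi> t) k) / 2)"
    if "A \<noteq> 0" "B \<noteq> 0"
  proof -
    have "A \<ge> 0" "B \<ge> 0" by (simp_all add: A B)
    with that have pos: "A > 0" "B > 0" by auto
    have sn: "u3 t = - P * jacobi_sn (\<psi> t) k / 2" and yU: "y t = 2 * U t + ln (B / A) / 2"
      if "t \<in> {0..t1}" for t
      using elliptic_solution[OF dU du3 U0 pos P Q k p0 \<psi> that] by (simp_all add: y)
    have "(y has_real_derivative 2 * u3 t) (at t within {0..t1})" if t: "t \<in> {0..t1}" for t
    proof (rule has_field_derivative_transform_within[OF _ zero_less_one t])
      show "((\<lambda>t. 2 * U t + ln (B / A) / 2) has_real_derivative 2 * u3 t) (at t within {0..t1})"
        by (rule derivative_eq_intros dU[OF t] refl)+ simp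
    qed (simp add: yU)
    then have "(y has_real_derivative - P * jacobi_sn (\<psi> t) k) (at t within {0..t1})"
      if "t \<in> {0..t1}" for t
      by (rule DERIV_cong) (use that sn[OF that] in auto)
    then show ?thesis using pos sn yU by (simp add: add_divide_distrib)
  qed

  from u6 d1 d2 d3 d4 d5 u45 A0 B0 case_I case_II case_III show ?thesis by blast
qed

end
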